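(* Let $e\in(0,1)$, let $T$ be a $t$-norm, let $S_M(x,y)=\max(x,y)$ on $[0,1]$, and let $U$ be the uninorm with identity element $e$ given by $$U(x,y)=\begin{cases} e\,T\!\left(\frac{x}{e},\frac{y}{e}\right), & (x,y)\in[0,e]^2,\\[2pt] e+(1-e)\,S_M\!\left(\frac{x-e}{1-e},\frac{y-e}{1-e}\right), & (x,y)\in[e,1]^2,\\[2pt] \min(x,y), & \text{otherwise.}\end{cases}$$ Let $\sigma:[0,1]\to[0,1]$ be a fuzzy subset and $B=\{x\in[0,1]:\sigma(x)\in[e,1]\}$. Then $\sigma$ is a $U$-fuzzy $t$-subconorm of $([0,1],S_M)$ if and only if $\sigma$ is increasing on $B$ (i.e. $x,y\in B$ and $x\le y$ imply $\sigma(x)\le\sigma(y)$) and $\sigma(0)=1$.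
   Context: A $t$-norm is a commutative, associative, coordinatewise non-decreasing operation on $[0,1]$ with identity $1$. A uninorm is a commutative, associative, coordinatewise non-decreasing operation on $[0,1]$ with an identity element in $[0,1]$. A $U$-fuzzy $t$-subconorm of $([0,1],S_M)$ is a map $\sigma:[0,1]\to[0,1]$ with $U(\sigma(x),\sigma(y))\le\sigma(S_M(x,y))$ for all $x,y\in[0,1]$ and $\sigma(0)=1$. *)

theory Defs
  imports Complex_Main "HOL-Library.FuncSet"
begin

text \<open>
  Operations and fuzzy subsets on \<open>[0,1]\<close> are functions on all of \<^typ>\<open>real\<close>. Every
  requirement is relativised to \<^term>\<open>{0..1::real}\<close>, and values outside are irrelevant.
\<close>

definition uninorm_with_identity :: "real \<Rightarrow> (real \<Rightarrow> real \<Rightarrow> real) \<Rightarrow> bool" where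
  "uninorm_with_identity e U \<longleftrightarrow>
     e \<in> {0..1} \<and>
     (\<forall>x\<in>{0..1}. \<forall>y\<in>{0..1}. U x y \<in> {0..1}) \<and>
     (\<forall>x\<in>{0..1}. \<forall>y\<in>{0..1}. U x y = U y x) \<and>
     (\<forall>x\<in>{0..1}. \<forall>y\<in>{0..1}. \<forall>z\<in>{0..1}. U (U x y) z = U x (U y z)) \<and>
     (\<forall>x\<in>{0..1}. \<forall>x'\<in>{0..1}. \<forall>y\<in>{0..1}. \<forall>y'\<in>{0..1}. x \<le> x' \<longrightarrow> y \<le> y' \<longrightarrow> U x y \<le> U x' y') \<and>
     (\<forall>x\<in>{0..1}. U e x = x)"

definition t_norm :: "(real \<Rightarrow> real \<Rightarrow> real) \<Rightarrow> bool" where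
  "t_norm T \<longleftrightarrow> uninorm_with_identity 1 T"

definition S_M :: "real \<Rightarrow> real \<Rightarrow> real" where
  "S_M x y = max x y"

text \<open>
  The cases overlap only where \<open>x = e\<close> and \<open>y = e\<close>. There both formulas give \<open>e\<close>, so the order
  of the tests does not matter.
\<close>

definition U_min :: "real \<Rightarrow> (real \<Rightarrow> real \<Rightarrow> real) \<Rightarrow> (real \<Rightarrow> real \<Rightarrow> real) \<Rightarrow> real \<Rightarrow> real \<Rightarrow> real" where
  "U_min e T S x y =
     (if x \<in> {0..e} \<and> y \<in> {0..e} then e * T (x / e) (y / e)
      else if x \<in> {e..1} \<and> y \<in> {e..1} then e + (1 - e) * S ((x - e) / (1 - e)) ((y - e) / (1 - e))
      else min x y)"

definition fuzzy_t_subconorm ::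
    "(real \<Rightarrow> real \<Rightarrow> real) \<Rightarrow> (real \<Rightarrow> real \<Rightarrow> real) \<Rightarrow> (real \<Rightarrow> real) \<Rightarrow> bool" where
  "fuzzy_t_subconorm U S \<sigma> \<longleftrightarrow>
     \<sigma> \<in> {0..1} \<rightarrow> {0..1} \<and>
     (\<forall>x\<in>{0..1}. \<forall>y\<in>{0..1}. U (\<sigma> x) (\<sigma> y) \<le> \<sigma> (S x y)) \<and>
     \<sigma> 0 = 1"

lemma U_min_S_M_eq:
  assumes "0 < e" "e < 1"
  shows "U_min e T S_M x y =
     (if x \<in> {0..e} \<and> y \<in> {0..e} then e * T (x / e) (y / e)
      else if x \<in> {e..1} \<and> y \<in> {e..1} then max x y
      else min x y)"
  using assms by (auto simp: U_min_def S_M_def max_def divide_le_cancel)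

lemma uninorm_with_identity_U_min:
  assumes e: "0 < e" "e < 1" and "t_norm T"
  shows "uninorm_with_identity e (U_min e T S_M)"
proof -
  define f where "f x y = e * T (x / e) (y / e)" for x y
  have T: "uninorm_with_identity 1 T" using assms(3) by (simp add: t_norm_def)
  have u: "x / e \<in> {0..1}" if "x \<in> {0..e}" for x using that e by auto
  have f_in: "f x y \<in> {0..e}" if "x \<in> {0..e}" "y \<in> {0..e}" for x y
  proof -
    have "T (x / e) (y / e) \<in> {0..1}"
      using T u[OF that(1)] u[OF that(2)] unfolding uninorm_with_identity_def by blast
    thus ?thesis using e by (auto simp: f_def mult_le_cancel_left1)
  qed
  have f_comm: "f x y = f y x" if "x \<in> {0..e}" "y \<in> {0..e}" for x y
    using T u[OF that(1)] u[OF that(2)] unfolding f_def uninorm_with_identity_def by metis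
  have f_assoc: "f (f x y) z = f x (f y z)" if "x \<in> {0..e}" "y \<in> {0..e}" "z \<in> {0..e}" for x y z
  proof -
    have "T (T (x / e) (y / e)) (z / e) = T (x / e) (T (y / e) (z / e))"
      using T u[OF that(1)] u[OF that(2)] u[OF that(3)] unfolding uninorm_with_identity_def by blast
    thus ?thesis using e by (simp add: f_def)
  qed
  have f_mono: "f x y \<le> f x' y'"
    if "x \<in> {0..e}" "y \<in> {0..e}" "x' \<in> {0..e}" "y' \<in> {0..e}" "x \<le> x'" "y \<le> y'" for x y x' y'
  proof -
    have "x / e \<le> x' / e" "y / e \<le> y' / e" using that e by (auto simp: divide_right_mono)
    hence "T (x / e) (y / e) \<le> T (x' / e) (y' / e)"
      using T u[OF that(1)] u[OF that(2)] u[OF that(3)] u[OF that(4)]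
      unfolding uninorm_with_identity_def by blast
    thus ?thesis using e by (simp add: f_def)
  qed
  have f_id: "f e x = x" if "x \<in> {0..e}" for x
  proof -
    have "T 1 (x / e) = x / e" using T u[OF that] unfolding uninorm_with_identity_def by blast
    thus ?thesis using e by (simp add: f_def)
  qed
  have f_id': "f x e = x" if "x \<in> {0..e}" for x
    using f_id[OF that] f_comm[OF that, of e] e by auto
  have f_le: "f x y \<le> x" "f x y \<le> y" if "x \<in> {0..e}" "y \<in> {0..e}" for x y
    using f_mono[of x y x e] f_mono[of x y e y] f_id f_id' that e by auto
  have f_in': "f x y \<in> {0..<e}" if "x \<in> {0..<e}" "y \<in> {0..<e}" for x y
    using f_in[of x y] f_le(1)[of x y] that by auto
  have f_comm': "f x y = f y x" if "x \<in> {0..<e}" "y \<in> {0..<e}" for x y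
    using f_comm that by auto
  have f_assoc': "f (f x y) z = f x (f y z)"
    if "x \<in> {0..<e}" "y \<in> {0..<e}" "z \<in> {0..<e}" for x y z
    using f_assoc that by auto
  define V where "V = U_min e T S_M"
  have low: "V x y = f x y" if "x \<in> {0..<e}" "y \<in> {0..<e}" for x y
    using that by (auto simp: V_def U_min_S_M_eq[OF e] f_def)
  have high: "V x y = max x y" if "x \<in> {e..1}" "y \<in> {e..1}" for x y
    using that e f_id[of e] by (auto simp: V_def U_min_S_M_eq[OF e] f_def)
  have lh: "V x y = x" if "x \<in> {0..<e}" "y \<in> {e..1}" for x y
    using that e f_id'[of x] by (auto simp: V_def U_min_S_M_eq[OF e] f_def)
  have hl: "V x y = y" if "x \<in> {e..1}" "y \<in> {0..<e}" for x y
    using that e f_id[of y] by (auto simp: V_def U_min_S_M_eq[OF e] f_def)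
  have cases: "x \<in> {0..<e} \<or> x \<in> {e..1}" if "x \<in> {0..1}" for x using that by auto
  have lowI: "x \<in> {0..1}" if "x \<in> {0..<e}" for x using that e by auto
  have max_in: "max x y \<in> {e..1}" if "x \<in> {e..1}" "y \<in> {e..1}" for x y using that by auto
  have V_in: "V x y \<in> {0..1}" if "x \<in> {0..1}" "y \<in> {0..1}" for x y
    using cases[OF that(1)] cases[OF that(2)]
  proof (elim disjE; simp only: low high lh hl)
    assume "x \<in> {0..<e}" "y \<in> {0..<e}"
    thus "f x y \<in> {0..1}" using lowI f_in' by blast
  qed (use that in auto)
  have V_comm: "V x y = V y x" if "x \<in> {0..1}" "y \<in> {0..1}" for x y
    using cases[OF that(1)] cases[OF that(2)]
    by (elim disjE; simp only: low high lh hl) (auto simp: max.commute f_comm')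
  have V_assoc: "V (V x y) z = V x (V y z)" if "x \<in> {0..1}" "y \<in> {0..1}" "z \<in> {0..1}" for x y z
    using cases[OF that(1)] cases[OF that(2)] cases[OF that(3)]
    by (elim disjE; simp only: low high lh hl f_in' max_in f_assoc' max.assoc)
  have V_mono1: "V x y \<le> V x' y"
    if "x \<in> {0..1}" "x' \<in> {0..1}" "y \<in> {0..1}" "x \<le> x'" for x x' y
    using cases[OF that(1)] cases[OF that(2)] cases[OF that(3)]
  proof (elim disjE; simp only: low high lh hl)
    assume "x \<in> {0..<e}" "x' \<in> {0..<e}" "y \<in> {0..<e}"
    thus "f x y \<le> f x' y" using f_mono that by auto
  next
    assume "x \<in> {0..<e}" "x' \<in> {e..1}" "y \<in> {0..<e}"
    thus "f x y \<le> y" using f_le(2)[of x y] by auto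
  qed (use that in auto)
  have V_mono: "V x y \<le> V x' y'"
    if "x \<in> {0..1}" "x' \<in> {0..1}" "y \<in> {0..1}" "y' \<in> {0..1}" "x \<le> x'" "y \<le> y'" for x x' y y'
    using V_mono1[of x x' y] V_mono1[of y y' x'] V_comm[of x' y] V_comm[of x' y'] that by linarith
  have V_id: "V e x = x" if "x \<in> {0..1}" for x
    using cases[OF that] hl[of e x] high[of e x] e by (auto simp: max_def)
  show ?thesis
    unfolding uninorm_with_identity_def V_def[symmetric]
    using e V_in V_comm V_assoc V_mono V_id by (intro conjI ballI impI) auto
qed

end

theory Submission
  imports Defs
begin

text \<open>On [e,1]^2 the uninorm is \<open>max\<close> (\<open>U_min_S_M_high\<close>), so for x
  \<le> y in B the subconorm inequality reads max (\<sigma> x) (\<sigma> y) \<le> \<sigma> y, which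
  is exactly \<sigma> x \<le> \<sigma> y. If x or y lies outside B, one of the two values is below
  e, and then the inequality holds for any \<sigma>: an argument at or below the identity e cannot
  raise the other one, and the mixed region gives the minimum
  (\<open>U_min_S_M_le_right\<close>).\<close>

text \<open>At a = b = e the first branch of \<open>U_min\<close> applies, so the case a = e is
  settled by the identity law rather than by the formula.\<close>

lemma U_min_S_M_high:
  assumes e: "0 < e" "e < 1" and T: "t_norm T" and "a \<in> {e..1}" "b \<in> {e..1}"
  shows "U_min e T S_M a b = max a b"
proof (cases "a = e")
  case True
  thus ?thesis
    using uninorm_with_identity_U_min[OF e T] assms by (auto simp: uninorm_with_identity_def)
next
  case False
  thus ?thesis
    using assms by (auto simp: U_min_S_M_eq)
qed

text \<open>For a \<le> e, monotonicity gives U(a,b) \<le> U(e,b) = b; for a > e and b < e, the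
  value is min a b.\<close>

lemma U_min_S_M_le_right:
  assumes e: "0 < e" "e < 1" and T: "t_norm T" and "a \<in> {0..1}" "b \<in> {0..1}" and "a \<le> e \<or> b < e"
  shows "U_min e T S_M a b \<le> b"
proof (cases "a \<le> e")
  case True
  have "e \<in> {0..1}" using e by simp
  then have "U_min e T S_M a b \<le> U_min e T S_M e b" and "U_min e T S_M e b = b"
    using uninorm_with_identity_U_min[OF e T] \<open>a \<in> {0..1}\<close> \<open>b \<in> {0..1}\<close> True
    unfolding uninorm_with_identity_def by blast+
  thus ?thesis by simp
next
  case False
  thus ?thesis using assms by (simp add: U_min_S_M_eq)
qed

theorem proposition3p6:
  fixes e :: real and T U :: "real \<Rightarrow> real \<Rightarrow> real" and \<sigma> :: "real \<Rightarrow> real" and B :: "real set"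
  assumes "e \<in> {0<..<1}"
    and "t_norm T"
    and "\<And>x y. x \<in> {0..1} \<Longrightarrow> y \<in> {0..1} \<Longrightarrow> U x y = U_min e T S_M x y"
    and "\<sigma> \<in> {0..1} \<rightarrow> {0..1}"
    and "B = {x \<in> {0..1}. \<sigma> x \<in> {e..1}}"
  shows "fuzzy_t_subconorm U S_M \<sigma> \<longleftrightarrow> mono_on B \<sigma> \<and> \<sigma> 0 = 1"
proof -
  have e: "0 < e" "e < 1" using assms(1) by auto
  note T = assms(2) and U = assms(3) and B = assms(5)
  have \<sigma>: "\<sigma> x \<in> {0..1}" if "x \<in> {0..1}" for x
    using assms(4) that by blast
  have high: "U (\<sigma> x) (\<sigma> y) = max (\<sigma> x) (\<sigma> y)" if "x \<in> B" "y \<in> B" for x y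
    using that U[of "\<sigma> x" "\<sigma> y"] \<sigma> U_min_S_M_high[OF e T] by (simp add: B)
  have "\<sigma> x \<le> \<sigma> y"
    if "fuzzy_t_subconorm U S_M \<sigma>" and "x \<in> B" "y \<in> B" "x \<le> y" for x y
  proof -
    have "U (\<sigma> x) (\<sigma> y) \<le> \<sigma> (S_M x y)"
      using that by (auto simp: fuzzy_t_subconorm_def B)
    thus ?thesis using that high by (simp add: S_M_def max_absorb2)
  qed
  moreover have "U (\<sigma> x) (\<sigma> y) \<le> \<sigma> (S_M x y)"
    if mono: "mono_on B \<sigma>" and "x \<in> {0..1}" "y \<in> {0..1}" for x y
  proof -
    \<comment> \<open>Both \<open>U\<close> and \<open>S_M\<close> are symmetric on [0,1], so x
      \<le> y may be assumed; then \<open>S_M x y\<close> = y.\<close>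
    have ordered: "U (\<sigma> x) (\<sigma> y) \<le> \<sigma> y" if xy: "x \<in> {0..1}" "y \<in> {0..1}" "x \<le> y" for x y
    proof (cases "x \<in> B \<and> y \<in> B")
      case True
      thus ?thesis using high mono_onD[OF mono, of x y] xy by simp
    next
      case False
      \<comment> \<open>Points of [0,1] outside B have values strictly below e.\<close>
      hence "\<sigma> x \<le> e \<or> \<sigma> y < e" using xy \<sigma>[of x] \<sigma>[of y] by (auto simp: B)
      thus ?thesis using U_min_S_M_le_right[OF e T] U \<sigma> xy by simp
    qed
    have "U (\<sigma> x) (\<sigma> y) = U (\<sigma> y) (\<sigma> x)"
      using uninorm_with_identity_U_min[OF e T] U[OF \<sigma> \<sigma>] \<sigma> that
      unfolding uninorm_with_identity_def by metis
    thus ?thesis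
      using ordered[of x y] ordered[of y x] that by (cases "x \<le> y") (auto simp: S_M_def max_def)
  qed
  ultimately show ?thesis
    using assms(4) by (auto simp: fuzzy_t_subconorm_def intro: mono_onI)
qed

end
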